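(* Let $m\ge 1$ be a fixed number of bins, let $v^*$ be the optimum stretching factor of online bin stretching with $m$ bins, and for each integer $g\ge 1$ let $u_g$ be the upper bound given by the min-max value of the upper bound game with granularity $g$ and $m$ bins. Then $$\lim_{g\to+\infty} u_g = v^*.$$
   Context: **Online bin stretching.** Fix an integer $m\ge 1$ (number of bins). An input is a finite sequence of items, each with a positive real size, such that the whole set of items can be partitioned into $m$ groups each of total size at most $1$ (i.e. it fits into $m$ bins of unit size). Let $\mathcal I$ be the set of all such inputs. A (deterministic) online algorithm $A$ is a sequence of functions $(A_1,A_2,\dots)$, where $A_i$ takes the first $i$ item sizes and outputs the index in $\{1,\dots,m\}$ of the bin into which the $i$-th item is irrevocably placed. There is no capacity limit on the bins used by the algorithm. Let $\mathcal A$ be the set of online algorithms. For $I\in\mathcal I$, $A(I)$ is the load (sum of item sizes) of the fullest bin after packing $I$ according to $A$. The stretching factor of $A$ is $r(A)=\sup_{I\in\mathcal I}A(I)$, and the optimum stretching factor is $v^*=\inf_{A\in\mathcal A}r(A)$. **Upper bound game with granularity $g\in\mathbb N^*$ and $m$ bins.** This is a two-player zero-sum perfect-information game between the adversary (maximizer) and the algorithm (minimizer). Each of the $m$ bins has a load class, a nonnegative integer, initially $0$. In each round: 1. the adversary sends an item of class $\bar y\in\mathbb N=\{0,1,2,\dots\}$; 2. the algorithm chooses a bin; 3. the adversary chooses whether an overflow occurs: the load class of the chosen bin increases by $\bar y$ if there is no overflow, and by $\bar y+1$ if there is an overflow. The adversary's moves must always respect the following constraints: - the item classes $\bar y_1,\dots,\bar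 y_k$ sent so far, viewed as integer sizes, fit into $m$ bins of size $g-1$; - the sum of the load classes of the $m$ bins is at most $mg-1$; - if the item sent has class $0$, an overflow must occur. The game ends when the adversary is unable to send any item. The score is (the highest load class of a bin, plus one), expressed in the unit in which the unit bin size equals $g$; thus the normalized score is (highest load class $+1$)$/g$. The number $u_g$ is the min-max value of this game for the normalized score. (Interpretation: class $\bar y$ represents sizes or loads in the interval $]\bar y/g,(\bar y+1)/g]$.) *)

theory Defs
  imports Complex_Main
begin

text \<open>Bins are numbered \<open>0, \<dots>, m - 1\<close> throughout; an assignment \<open>p\<close> puts the item with
  index \<open>i\<close> of the list \<open>xs\<close> into bin \<open>p i\<close>.\<close>

definition bin_load :: "'a::comm_monoid_add list \<Rightarrow> (nat \<Rightarrow> nat) \<Rightarrow> nat \<Rightarrow> 'a" where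
  "bin_load xs p j = (\<Sum>i | i < length xs \<and> p i = j. xs ! i)"

definition fits :: "nat \<Rightarrow> 'a::{comm_monoid_add, ord} \<Rightarrow> 'a list \<Rightarrow> bool" where
  "fits m c xs \<longleftrightarrow>
     (\<exists>p. (\<forall>i<length xs. p i < m) \<and> (\<forall>j<m. bin_load xs p j \<le> c))"


subsection \<open>Online bin stretching\<close>

definition inputs :: "nat \<Rightarrow> real list set" where
  "inputs m = {xs. (\<forall>x\<in>set xs. 0 < x) \<and> fits m 1 xs}"

text \<open>The sequence \<open>(A\<^sub>1, A\<^sub>2, \<dots>)\<close> is encoded as one function on lists, whose
  restriction to lists of length \<open>i\<close> is \<open>A\<^sub>i\<close>; the value on the empty list is never used.\<close>

definition algorithms :: "nat \<Rightarrow> (real list \<Rightarrow> nat) set" where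
  "algorithms m = {A. \<forall>xs. A xs < m}"

definition max_load :: "nat \<Rightarrow> (real list \<Rightarrow> nat) \<Rightarrow> real list \<Rightarrow> real" where
  "max_load m A xs = (MAX j\<in>{..<m}. bin_load xs (\<lambda>i. A (take (Suc i) xs)) j)"

text \<open>For \<open>m \<ge> 1\<close> the real-valued supremum and infimum below are over nonempty sets bounded
  by \<open>0\<close> and \<open>m\<close>, since the total size of an input is at most \<open>m\<close>.\<close>

definition stretching_factor :: "nat \<Rightarrow> (real list \<Rightarrow> nat) \<Rightarrow> real" where
  "stretching_factor m A = (SUP xs\<in>inputs m. max_load m A xs)"

definition optimum_stretching_factor :: "nat \<Rightarrow> real" where
  "optimum_stretching_factor m = (INF A\<in>algorithms m. stretching_factor m A)"


subsection \<open>The upper bound game\<close>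

text \<open>A position at the start of a round consists of the classes \<open>ys\<close> sent so far and the
  load classes \<open>l\<close> of the bins. The total load after a round does not depend on the bin
  chosen by the algorithm, so neither does the set of legal overflow decisions
  (\<open>True\<close> means overflow). An item may be sent only if some overflow decision is legal
  afterwards.\<close>

definition legal_overflows :: "nat \<Rightarrow> nat \<Rightarrow> (nat \<Rightarrow> nat) \<Rightarrow> nat \<Rightarrow> bool set" where
  "legal_overflows m g l y =
     {q. (y = 0 \<longrightarrow> q) \<and> (\<Sum>j<m. l j) + (y + of_bool q) \<le> m * g - 1}"

definition legal_items :: "nat \<Rightarrow> nat \<Rightarrow> nat list \<Rightarrow> (nat \<Rightarrow> nat) \<Rightarrow> nat set" where
  "legal_items m g ys l =
     {y. fits m (g - 1) (ys @ [y]) \<and> legal_overflows m g l y \<noteq> {}}"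

definition score :: "nat \<Rightarrow> nat \<Rightarrow> (nat \<Rightarrow> nat) \<Rightarrow> real" where
  "score m g l = real ((MAX j\<in>{..<m}. l j) + 1) / real g"

lemma finite_legal_items: "finite (legal_items m g ys l)"
  by (rule finite_subset[of _ "{..m * g - 1}"])
    (auto simp: legal_items_def legal_overflows_def)

text \<open>The min-max value of the game continued from a given position. The total load strictly
  increases in each round, because class \<open>0\<close> items overflow, so every play is finite.\<close>

function game_value :: "nat \<Rightarrow> nat \<Rightarrow> nat list \<Rightarrow> (nat \<Rightarrow> nat) \<Rightarrow> real" where
  "game_value m g ys l =
     (if legal_items m g ys l = {} then score m g l
      else MAX y\<in>legal_items m g ys l. MIN b\<in>{..<m}. MAX q\<in>legal_overflows m g l y.
             game_value m g (ys @ [y]) (l(b := l b + (y + of_bool q))))"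
  by pat_completeness auto
termination
proof (relation "measure (\<lambda>(m, g, ys, l). m * g - (\<Sum>j<m. l j))", goal_cases)
  case (2 m g ys l y b q)
  have "(\<Sum>j<m. (l(b := l b + (y + of_bool q))) j) = (\<Sum>j<m. l j) + (y + of_bool q)"
    using 2 by (simp add: sum.remove[of "{..<m}" b])
  moreover have "0 < y + of_bool q" "(\<Sum>j<m. l j) + (y + of_bool q) \<le> m * g - 1"
    using 2 by (auto simp: legal_overflows_def)
  ultimately have "m * g - (\<Sum>j<m. (l(b := l b + (y + of_bool q))) j) < m * g - (\<Sum>j<m. l j)"
    by linarith
  then show ?case by simp
qed simp

declare game_value.simps [simp del]

definition upper_bound :: "nat \<Rightarrow> nat \<Rightarrow> real" where
  "upper_bound m g = game_value m g [] (\<lambda>_. 0)"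

end

theory Submission
  imports Defs "HOL-Library.Multiset" "HOL-Real_Asymp.Real_Asymp"
begin

text \<open>Every game value is an upper bound: an online algorithm can copy optimal play of the game,
  rounding each item and each bin load \<open>x\<close> to a class \<open>y\<close> with \<open>y \<le> x g \<le> y + 1\<close>. Conversely,
  an online algorithm \<open>A\<close> yields a strategy for the game. Rounding up is harmless for the items of
  class at least \<open>K\<close>, since it enlarges them by a factor at most \<open>1 + 1/K\<close>. The smaller ones are
  aggregated into grains of fixed size, which hides the overflow decisions taken after
  their placement. Hence \<open>u\<^sub>g\<close> exceeds the stretching factor of \<open>A\<close> at most by a
  factor tending to \<open>K / (K - 1)\<close> as \<open>g\<close> grows, up to the rounding error \<open>1/g\<close>.\<close>


section \<open>Packings\<close>

lemma bin_load_snoc: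
  "bin_load (xs @ [x]) p j = bin_load xs p j + (if p (length xs) = j then x else 0)"
proof -
  have eq: "{i. i < length (xs @ [x]) \<and> p i = j} =
    {i. i < length xs \<and> p i = j} \<union> (if p (length xs) = j then {length xs} else {})"
    by (auto simp: less_Suc_eq)
  have "(\<Sum>i | i < length xs \<and> p i = j. (xs @ [x]) ! i) = bin_load xs p j"
    unfolding bin_load_def by (intro sum.cong) (auto simp: nth_append)
  then show ?thesis
    unfolding bin_load_def[of "xs @ [x]"] eq by (subst sum.union_disjoint) auto
qed

lemma bin_load_cong:
  "(\<And>i. i < length xs \<Longrightarrow> p i = q i) \<Longrightarrow> bin_load xs p j = bin_load xs q j"
  unfolding bin_load_def by (intro sum.cong) auto

lemma mset_partition_of_assignment:
  assumes "\<forall>i<length xs. p i < m"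
  shows "\<exists>B. mset xs = (\<Sum>j<m. B j) \<and> (\<forall>j<m. sum_mset (B j) = bin_load xs p j)"
  using assms
proof (induction xs rule: rev_induct)
  case Nil
  show ?case by (rule exI[of _ "\<lambda>_. {#}"]) (simp add: bin_load_def)
next
  case (snoc x xs)
  then obtain B where B: "mset xs = (\<Sum>j<m. B j)" "\<forall>j<m. sum_mset (B j) = bin_load xs p j"
    by force
  let ?k = "p (length xs)"
  have k: "?k < m" using snoc.prems by auto
  let ?B = "B(?k := add_mset x (B ?k))"
  have "(\<Sum>j<m. ?B j) = add_mset x (\<Sum>j<m. B j)"
    using k by (simp add: sum.remove[of "{..<m}" ?k])
  then show ?case using B k
    by (intro exI[of _ ?B]) (auto simp: bin_load_snoc add.commute)
qed

text \<open>Induction from the right end: the last item is taken out of some part \<open>B k\<close>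
  that contains it, the rest is assigned by induction, and the item is sent to
  \<open>k\<close>.\<close>

lemma assignment_of_mset_partition:
  fixes xs :: "'a::comm_monoid_add list"
  assumes "mset xs = (\<Sum>j<m. B j)"
  shows "\<exists>p. (\<forall>i<length xs. p i < m) \<and> (\<forall>j<m. bin_load xs p j = sum_mset (B j))"
  using assms
proof (induction xs arbitrary: B rule: rev_induct)
  case Nil
  then have "\<forall>j<m. B j = {#}" by (simp add: sum_eq_empty_iff)
  then show ?case by (auto simp: bin_load_def)
next
  case (snoc x xs)
  have "x \<in># (\<Sum>j<m. B j)" by (simp flip: snoc.prems)
  then obtain k where k: "k < m" "x \<in># B k"
    by (auto simp: set_mset_sum)
  let ?B = "B(k := B k - {#x#})"
  have "add_mset x (\<Sum>j<m. ?B j) = (\<Sum>j<m. B j)"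
    using k by (simp add: sum.remove[of "{..<m}" k] flip: union_mset_add_mset_left)
  then have "mset xs = (\<Sum>j<m. ?B j)"
    using snoc.prems by (metis add_mset_add_single add_mset_remove_trivial mset_append mset_single_iff_right)
  then obtain p where p: "\<forall>i<length xs. p i < m" "\<forall>j<m. bin_load xs p j = sum_mset (?B j)"
    using snoc.IH by blast
  define p' where "p' = p(length xs := k)"
  have "bin_load xs p' j = bin_load xs p j" for j
    by (rule bin_load_cong) (simp add: p'_def)
  then have "bin_load (xs @ [x]) p' j = bin_load xs p j + (if k = j then x else 0)" for j
    unfolding bin_load_snoc by (simp add: p'_def)
  moreover have "\<forall>i<length (xs @ [x]). p' i < m"
    using p(1) k(1) by (simp add: p'_def less_Suc_eq)
  moreover have "sum_mset (B k) = x + sum_mset (B k - {#x#})"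
    using multi_member_split[OF k(2)] by auto
  ultimately show ?case using p(2)
    by (intro exI[of _ p']) (auto simp: add.commute)
qed

text \<open>Fitting does not depend on the order of the items. In this form rounding, filtering and
  removing items act on the parts of a packing without renumbering.\<close>

lemma fits_iff_mset:
  "fits m c xs \<longleftrightarrow> (\<exists>B. mset xs = (\<Sum>j<m. B j) \<and> (\<forall>j<m. sum_mset (B j) \<le> c))"
proof
  assume "fits m c xs"
  then obtain p where p: "\<forall>i<length xs. p i < m" "\<forall>j<m. bin_load xs p j \<le> c"
    unfolding fits_def by blast
  then show "\<exists>B. mset xs = (\<Sum>j<m. B j) \<and> (\<forall>j<m. sum_mset (B j) \<le> c)"
    using mset_partition_of_assignment[OF p(1)] by metis
next
  assume "\<exists>B. mset xs = (\<Sum>j<m. B j) \<and> (\<forall>j<m. sum_mset (B j) \<le> c)"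
  then obtain B where B: "mset xs = (\<Sum>j<m. B j)" "\<forall>j<m. sum_mset (B j) \<le> c"
    by blast
  show "fits m c xs"
    using assignment_of_mset_partition[OF B(1)] B(2) unfolding fits_def by metis
qed

lemma image_mset_sum: "image_mset f (\<Sum>j\<in>A. B j) = (\<Sum>j\<in>A. image_mset f (B j))"
  by (induction A rule: infinite_finite_induct) auto

lemma filter_mset_sum: "filter_mset P (\<Sum>j\<in>A. B j) = (\<Sum>j\<in>A. filter_mset P (B j))"
  by (induction A rule: infinite_finite_induct) auto

lemma sum_mset_sum: "sum_mset (\<Sum>j\<in>A. B j) = (\<Sum>j\<in>A. sum_mset (B j))"
  by (induction A rule: infinite_finite_induct) auto

lemma fits_appendD:
  fixes xs zs :: "'a::ordered_comm_monoid_add list"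
  assumes "fits m c (xs @ zs)" "\<forall>z\<in>set zs. 0 \<le> z"
  shows "fits m c xs"
  using assms
proof (induction zs rule: rev_induct)
  case (snoc z zs)
  have "0 \<le> z" using snoc.prems by auto
  have "fits m c (xs @ zs)"
    unfolding fits_def
  proof -
    obtain p where p: "\<forall>i<length (xs @ zs @ [z]). p i < m" "\<forall>j<m. bin_load (xs @ zs @ [z]) p j \<le> c"
      using snoc.prems unfolding fits_def by blast
    have "bin_load (xs @ zs) p j \<le> bin_load ((xs @ zs) @ [z]) p j" for j
      unfolding bin_load_snoc using \<open>0 \<le> z\<close> by (simp add: add_increasing2)
    with p have "\<forall>j<m. bin_load (xs @ zs) p j \<le> c"
      using order_trans by fastforce
    with p(1) show "\<exists>p. (\<forall>i<length (xs @ zs). p i < m) \<and> (\<forall>j<m. bin_load (xs @ zs) p j \<le> c)"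
      by (intro exI[of _ p]) auto
  qed
  with snoc show ?case by simp
qed simp

lemma fits_subset_mset:
  fixes xs ys :: "nat list"
  assumes "fits m c xs" "mset ys \<subseteq># mset xs"
  shows "fits m c ys"
proof -
  obtain zs where "mset zs = mset xs - mset ys" using ex_mset by blast
  with assms have "mset (ys @ zs) = mset xs" by simp
  with assms(1) have "fits m c (ys @ zs)" unfolding fits_iff_mset by metis
  then show ?thesis by (rule fits_appendD) simp
qed

lemma sum_list_le_of_fits:
  fixes xs :: "'a::linordered_semidom list"
  assumes "fits m c xs"
  shows "sum_list xs \<le> of_nat m * c"
proof -
  from assms obtain B where B: "mset xs = (\<Sum>j<m. B j)" "\<forall>j<m. sum_mset (B j) \<le> c"
    unfolding fits_iff_mset by blast
  have "sum_list xs = (\<Sum>j<m. sum_mset (B j))"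
    by (metis B(1) sum_mset_sum sum_mset_sum_list)
  also have "\<dots> \<le> of_nat m * c"
    using sum_bounded_above[of "{..<m}" "\<lambda>j. sum_mset (B j)" c] B(2) by simp
  finally show ?thesis .
qed

text \<open>While the total is at most \<open>m * (c - \<gamma>)\<close>, the average bin load is at
  most \<open>c - \<gamma>\<close>, so some bin has room for one more item of size
  \<open>\<gamma>\<close>.\<close>

lemma greedy_partition:
  fixes c \<gamma> :: real and m N :: nat
  assumes "m \<ge> 1" "0 \<le> \<gamma>" "M = (\<Sum>j<m. B j)" "\<forall>j<m. sum_mset (B j) \<le> c"
    and "sum_mset M + N * \<gamma> \<le> m * (c - \<gamma>)"
  shows "\<exists>B. M + replicate_mset N \<gamma> = (\<Sum>j<m. B j) \<and> (\<forall>j<m. sum_mset (B j) \<le> c)"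
  using assms(5)
proof (induction N)
  case 0
  then show ?case using assms by auto
next
  case (Suc N)
  then have le: "sum_mset M + N * \<gamma> \<le> m * (c - \<gamma>)"
    using assms(2) by (simp add: algebra_simps)
  then obtain B where B: "M + replicate_mset N \<gamma> = (\<Sum>j<m. B j)" "\<forall>j<m. sum_mset (B j) \<le> c"
    using Suc.IH by blast
  have "\<exists>k<m. sum_mset (B k) \<le> c - \<gamma>"
  proof (rule ccontr)
    assume "\<not> ?thesis"
    then have "(\<Sum>j<m. c - \<gamma>) < (\<Sum>j<m. sum_mset (B j))"
      using assms(1) by (intro sum_strict_mono) (auto simp: lessThan_empty_iff)
    also have "\<dots> = sum_mset M + N * \<gamma>"
      by (simp flip: sum_mset_sum B(1))
    finally show False using le by simp
  qed
  then obtain k where k: "k < m" "sum_mset (B k) \<le> c - \<gamma>" by blast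
  let ?B = "B(k := add_mset \<gamma> (B k))"
  have "(\<Sum>j<m. ?B j) = add_mset \<gamma> (\<Sum>j<m. B j)"
    using k by (simp add: sum.remove[of "{..<m}" k])
  then have "M + replicate_mset (Suc N) \<gamma> = (\<Sum>j<m. ?B j)"
    unfolding B(1)[symmetric] by simp
  moreover have "\<forall>j<m. sum_mset (?B j) \<le> c" using B(2) k by auto
  ultimately show ?case by blast
qed


section \<open>Loads produced by an online algorithm\<close>

definition alg_load :: "(real list \<Rightarrow> nat) \<Rightarrow> real list \<Rightarrow> nat \<Rightarrow> real" where
  "alg_load A xs = bin_load xs (\<lambda>i. A (take (Suc i) xs))"

lemma alg_load_Nil [simp]: "alg_load A [] j = 0"
  by (simp add: alg_load_def bin_load_def)

text \<open>This is the online property: a new item does not change the prefixes on which the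
  earlier placements depend.\<close>

lemma alg_load_snoc:
  "alg_load A (xs @ [x]) j = alg_load A xs j + (if A (xs @ [x]) = j then x else 0)"
proof -
  have "bin_load xs (\<lambda>i. A (take (Suc i) (xs @ [x]))) j = bin_load xs (\<lambda>i. A (take (Suc i) xs)) j"
    by (rule bin_load_cong) simp
  then show ?thesis unfolding alg_load_def bin_load_snoc by simp
qed

lemma sum_alg_load:
  assumes "A \<in> algorithms m"
  shows "(\<Sum>j<m. alg_load A xs j) = sum_list xs"
proof (induction xs rule: rev_induct)
  case (snoc x xs)
  have "A (xs @ [x]) < m" using assms by (simp add: algorithms_def)
  then show ?case using snoc by (simp add: alg_load_snoc sum.distrib)
qed simp

lemma alg_load_nonneg:
  "\<forall>x\<in>set xs. 0 < x \<Longrightarrow> 0 \<le> alg_load A xs j"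
  by (induction xs rule: rev_induct) (auto simp: alg_load_snoc)

section \<open>Inputs, stretching factors and their bounds\<close>

lemma inputs_prefix:
  assumes "xs @ [x] \<in> inputs m"
  shows "xs \<in> inputs m" "0 < x"
  using assms fits_appendD[of m 1 xs "[x]"] by (auto simp: inputs_def)

lemma Nil_in_inputs: "m \<ge> 1 \<Longrightarrow> [] \<in> inputs m"
  by (auto simp: inputs_def fits_def bin_load_def)

lemma max_load_eq: "max_load m A xs = (MAX j\<in>{..<m}. alg_load A xs j)"
  by (simp add: max_load_def alg_load_def)

lemma alg_load_le_m:
  assumes "A \<in> algorithms m" "xs \<in> inputs m" "j < m"
  shows "alg_load A xs j \<le> m"
proof -
  have "alg_load A xs j \<le> (\<Sum>j<m. alg_load A xs j)"
    using assms by (intro member_le_sum) (auto simp: inputs_def alg_load_nonneg)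
  also have "\<dots> \<le> m"
    using sum_list_le_of_fits[of m 1 xs] assms by (simp add: sum_alg_load inputs_def)
  finally show ?thesis .
qed

lemma alg_load_le_stretching_factor:
  assumes "A \<in> algorithms m" "xs \<in> inputs m" "j < m"
  shows "alg_load A xs j \<le> stretching_factor m A"
proof -
  have "max_load m A ys \<le> m" if "ys \<in> inputs m" for ys
    using assms(1,3) that alg_load_le_m unfolding max_load_eq
    by (subst Max_le_iff) auto
  then have "bdd_above (max_load m A ` inputs m)"
    by (rule bdd_aboveI2)
  then have "max_load m A xs \<le> stretching_factor m A"
    unfolding stretching_factor_def using assms(2) by (intro cSUP_upper)
  moreover have "alg_load A xs j \<le> max_load m A xs"
    unfolding max_load_eq using assms(3) by (intro Max_ge) auto
  ultimately show ?thesis by linarith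
qed

lemma stretching_factor_nonneg:
  assumes "m \<ge> 1" "A \<in> algorithms m"
  shows "0 \<le> stretching_factor m A"
  using alg_load_le_stretching_factor[OF assms(2) Nil_in_inputs[OF assms(1)], of 0] assms(1) by simp

lemma stretching_factor_le:
  assumes "m \<ge> 1" "\<And>xs j. xs \<in> inputs m \<Longrightarrow> j < m \<Longrightarrow> alg_load A xs j \<le> u"
  shows "stretching_factor m A \<le> u"
  unfolding stretching_factor_def
proof (rule cSUP_least)
  show "inputs m \<noteq> {}" using Nil_in_inputs[OF assms(1)] by auto
  show "max_load m A xs \<le> u" if "xs \<in> inputs m" for xs
    unfolding max_load_eq using assms that by (subst Max_le_iff) (auto simp: lessThan_empty_iff)
qed

lemma optimum_le_stretching_factor:
  assumes "m \<ge> 1" "A \<in> algorithms m"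
  shows "optimum_stretching_factor m \<le> stretching_factor m A"
  unfolding optimum_stretching_factor_def
  by (rule cINF_lower) (use assms stretching_factor_nonneg in \<open>auto intro!: bdd_belowI2[of _ 0]\<close>)

lemma le_optimum_stretching_factor:
  assumes "m \<ge> 1" "\<And>A. A \<in> algorithms m \<Longrightarrow> u \<le> stretching_factor m A"
  shows "u \<le> optimum_stretching_factor m"
  unfolding optimum_stretching_factor_def
proof (rule cINF_greatest)
  show "algorithms m \<noteq> {}" using assms(1) by (auto simp: algorithms_def intro!: exI[of _ "\<lambda>_. 0"])
qed (use assms in auto)


section \<open>Values of the upper bound game\<close>

definition reply_value :: "nat \<Rightarrow> nat \<Rightarrow> nat list \<Rightarrow> (nat \<Rightarrow> nat) \<Rightarrow> nat \<Rightarrow> nat \<Rightarrow> real" where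
  "reply_value m g ys l y b = (MAX q\<in>legal_overflows m g l y.
     game_value m g (ys @ [y]) (l(b := l b + (y + of_bool q))))"

lemma game_value_unfold:
  "game_value m g ys l =
     (if legal_items m g ys l = {} then score m g l
      else MAX y\<in>legal_items m g ys l. MIN b\<in>{..<m}. reply_value m g ys l y b)"
  unfolding reply_value_def by (subst game_value.simps) simp

text \<open>One round of a strategy of the algorithm: since it minimizes, a single good bin per item
  suffices, provided that the bin is chosen before the overflow decision.\<close>

lemma game_value_le:
  assumes "m \<ge> 1" "legal_items m g ys l = {} \<Longrightarrow> score m g l \<le> u"
    and "\<And>y. y \<in> legal_items m g ys l \<Longrightarrow> \<exists>b<m. \<forall>q\<in>legal_overflows m g l y.
      game_value m g (ys @ [y]) (l(b := l b + (y + of_bool q))) \<le> u"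
  shows "game_value m g ys l \<le> u"
proof (cases "legal_items m g ys l = {}")
  case True
  then show ?thesis using assms by (simp add: game_value_unfold)
next
  case False
  have "(MIN b\<in>{..<m}. reply_value m g ys l y b) \<le> u" if y: "y \<in> legal_items m g ys l" for y
  proof -
    obtain b where b: "b < m" "\<forall>q\<in>legal_overflows m g l y.
      game_value m g (ys @ [y]) (l(b := l b + (y + of_bool q))) \<le> u"
      using assms(3)[OF y] by blast
    have "legal_overflows m g l y \<noteq> {}" using y by (simp add: legal_items_def)
    then have "reply_value m g ys l y b \<le> u"
      unfolding reply_value_def using b(2) by (subst Max_le_iff) auto
    moreover have "(MIN b\<in>{..<m}. reply_value m g ys l y b) \<le> reply_value m g ys l y b"
      using b(1) by (intro Min_le) auto
    ultimately show ?thesis by linarith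
  qed
  then show ?thesis
    using False finite_legal_items by (subst game_value_unfold) simp
qed

lemma game_value_ge_min_reply:
  assumes "y \<in> legal_items m g ys l"
  shows "(MIN b\<in>{..<m}. reply_value m g ys l y b) \<le> game_value m g ys l"
proof -
  have "(MIN b\<in>{..<m}. reply_value m g ys l y b) \<le>
    (MAX y\<in>legal_items m g ys l. MIN b\<in>{..<m}. reply_value m g ys l y b)"
    using assms finite_legal_items by (intro Max_ge) auto
  then show ?thesis using assms by (subst game_value_unfold) auto
qed

lemma reply_value_ge:
  "q \<in> legal_overflows m g l y \<Longrightarrow>
   game_value m g (ys @ [y]) (l(b := l b + (y + of_bool q))) \<le> reply_value m g ys l y b"
  unfolding reply_value_def by (intro Max_ge) auto

lemma score_mono:
  assumes "m \<ge> 1" "\<And>j. l j \<le> l' j"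
  shows "score m g l \<le> score m g l'"
proof -
  have "(MAX j\<in>{..<m}. l j) \<le> (MAX j\<in>{..<m}. l' j)"
  proof (subst Max_le_iff)
    show "\<forall>a\<in>l ` {..<m}. a \<le> (MAX j\<in>{..<m}. l' j)"
      using assms(2) by (auto intro!: Max_ge_iff[THEN iffD2])
  qed (use assms(1) in \<open>auto simp: lessThan_empty_iff\<close>)
  then show ?thesis unfolding score_def by (intro divide_right_mono) auto
qed

lemma ex_min_reply:
  assumes "m \<ge> 1"
  shows "\<exists>b<m. reply_value m g ys l y b = (MIN b\<in>{..<m}. reply_value m g ys l y b)"
proof -
  have "(MIN b\<in>{..<m}. reply_value m g ys l y b) \<in> reply_value m g ys l y ` {..<m}"
    using assms by (intro Min_in) (auto simp: lessThan_empty_iff)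
  then show ?thesis by (auto simp: image_iff)
qed

text \<open>Load classes never decrease, so any legal continuation by the adversary keeps the
  current score. This matters because an input may end before the game does.\<close>

lemma score_le_game_value:
  "m \<ge> 1 \<Longrightarrow> score m g l \<le> game_value m g ys l"
proof (induction m g ys l rule: game_value.induct)
  case (1 m g ys l)
  show ?case
  proof (cases "legal_items m g ys l = {}")
    case True
    then show ?thesis by (simp add: game_value_unfold)
  next
    case False
    then obtain y where y: "y \<in> legal_items m g ys l" by blast
    then obtain q where q: "q \<in> legal_overflows m g l y" by (auto simp: legal_items_def)
    obtain b where b: "b < m"
      "reply_value m g ys l y b = (MIN b\<in>{..<m}. reply_value m g ys l y b)"
      using ex_min_reply[OF "1.prems"] by blast
    let ?l = "l(b := l b + (y + of_bool q))"
    have "score m g l \<le> score m g ?l"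
      using "1.prems" by (intro score_mono) auto
    also have "\<dots> \<le> game_value m g (ys @ [y]) ?l"
      using "1.IH"[OF False y _ q, of b] b(1) "1.prems" by (simp add: fun_upd_def)
    also have "\<dots> \<le> reply_value m g ys l y b"
      by (rule reply_value_ge[OF q])
    also have "\<dots> \<le> game_value m g ys l"
      using game_value_ge_min_reply[OF y] b(2) by simp
    finally show ?thesis .
  qed
qed


section \<open>From the game to online algorithms\<close>

definition item_class :: "nat \<Rightarrow> real \<Rightarrow> nat" where
  "item_class g x = nat (\<lceil>x * g\<rceil> - 1)"

text \<open>The ceiling minus one gives intervals open on the left and closed on the right. For
  positive \<open>x\<close> it is nonnegative, so \<open>nat\<close> truncates nothing.\<close>

lemma item_class_bounds:
  fixes x :: real
  assumes "0 < x" "g \<ge> 1"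
  shows "item_class g x < x * g" "x * g \<le> item_class g x + 1"
proof -
  have "0 < x * g" using assms by simp
  then show "item_class g x < x * g" "x * g \<le> item_class g x + 1"
    unfolding item_class_def by linarith+
qed

text \<open>Strictness is the point: the classes of items filling a unit bin sum to an integer below
  \<open>g\<close>, hence to at most \<open>g - 1\<close>.\<close>

lemma sum_item_class_less:
  fixes M :: "real multiset"
  assumes "g \<ge> 1" "\<forall>x\<in>#M. 0 < x" "M \<noteq> {#}"
  shows "real (sum_mset (image_mset (item_class g) M)) < sum_mset M * g"
  using assms(3,2)
proof (induction M rule: multiset_induct)
  case (add x M)
  then show ?case
    using item_class_bounds(1)[of x g] assms(1) by (cases "M = {#}") (auto simp: algebra_simps)
qed simp

lemma fits_item_class:
  assumes "xs \<in> inputs m" "g \<ge> 1"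
  shows "fits m (g - 1) (map (item_class g) xs)"
proof -
  obtain B where B: "mset xs = (\<Sum>j<m. B j)" "\<forall>j<m. sum_mset (B j) \<le> 1"
    using assms(1) unfolding inputs_def fits_iff_mset by blast
  let ?B = "\<lambda>j. image_mset (item_class g) (B j)"
  have "sum_mset (?B j) \<le> g - 1" if "j < m" for j
  proof (cases "B j = {#}")
    case False
    have "set_mset (B j) \<subseteq> set xs"
      using that B(1) by (metis UN_upper finite_lessThan lessThan_iff set_mset_mset set_mset_sum)
    then have "real (sum_mset (?B j)) < sum_mset (B j) * g"
      using assms False by (intro sum_item_class_less) (auto simp: inputs_def)
    also have "\<dots> \<le> g" using B(2) that mult_right_mono[of "sum_mset (B j)" 1 g] by simp
    finally show ?thesis by linarith
  qed simp
  moreover have "mset (map (item_class g) xs) = (\<Sum>j<m. ?B j)"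
    by (simp add: B(1) image_mset_sum)
  ultimately show ?thesis unfolding fits_iff_mset by blast
qed

text \<open>In the game an item of class \<open>0\<close> always overflows. The simulation therefore hides such an
  item from the game whenever some bin can receive it without leaving its load class.\<close>

definition hidden_in :: "nat \<Rightarrow> nat \<Rightarrow> (nat \<Rightarrow> nat) \<Rightarrow> (nat \<Rightarrow> real) \<Rightarrow> real \<Rightarrow> nat \<Rightarrow> bool" where
  "hidden_in m g l L x b \<longleftrightarrow> b < m \<and> item_class g x = 0 \<and> (L b + x) * g \<le> l b + 1"

text \<open>A state \<open>(ys, l, L)\<close> holds the classes shown to the game, the load classes
  of the game, and the real loads.\<close>

fun sim_bin :: "nat \<Rightarrow> nat \<Rightarrow> nat list \<times> (nat \<Rightarrow> nat) \<times> (nat \<Rightarrow> real) \<Rightarrow> real \<Rightarrow> nat" where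
  "sim_bin m g (ys, l, L) x =
     (if \<exists>b. hidden_in m g l L x b then SOME b. hidden_in m g l L x b
      else SOME b. b < m \<and> reply_value m g ys l (item_class g x) b =
        (MIN b\<in>{..<m}. reply_value m g ys l (item_class g x) b))"

text \<open>The overflow decision of the adversary is read off from the real load: it is an overflow
  if the load exceeds the upper end of class \<open>l b + y\<close>.\<close>

fun sim_next :: "nat \<Rightarrow> nat \<Rightarrow> nat list \<times> (nat \<Rightarrow> nat) \<times> (nat \<Rightarrow> real) \<Rightarrow> real \<Rightarrow>
    nat list \<times> (nat \<Rightarrow> nat) \<times> (nat \<Rightarrow> real)" where
  "sim_next m g (ys, l, L) x =
     (let b = sim_bin m g (ys, l, L) x; y = item_class g x; L' = (L(b := L b + x) :: nat \<Rightarrow> real) in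
      if \<exists>b. hidden_in m g l L x b then (ys, l, L')
      else (ys @ [y], l(b := l b + (y + of_bool (l b + y + 1 < L' b * g))), L'))"

definition sim_state :: "nat \<Rightarrow> nat \<Rightarrow> real list \<Rightarrow> nat list \<times> (nat \<Rightarrow> nat) \<times> (nat \<Rightarrow> real)" where
  "sim_state m g xs = foldl (sim_next m g) ([], \<lambda>_. 0, \<lambda>_. 0) xs"

text \<open>An online algorithm sees only the list of items, so it recovers its state by replaying
  all of them but the last.\<close>

definition sim_alg :: "nat \<Rightarrow> nat \<Rightarrow> real list \<Rightarrow> nat" where
  "sim_alg m g xs = sim_bin m g (sim_state m g (butlast xs)) (last xs)"

lemma sim_bin_hidden:
  "\<exists>b. hidden_in m g l L x b \<Longrightarrow> hidden_in m g l L x (sim_bin m g (ys, l, L) x)"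
  by (auto intro: someI_ex)

lemma sim_bin_visible:
  assumes "m \<ge> 1" "\<not> (\<exists>b. hidden_in m g l L x b)" "b = sim_bin m g (ys, l, L) x"
  shows "b < m \<and> reply_value m g ys l (item_class g x) b =
        (MIN b\<in>{..<m}. reply_value m g ys l (item_class g x) b)"
proof -
  have "b = (SOME b. b < m \<and> reply_value m g ys l (item_class g x) b =
        (MIN b\<in>{..<m}. reply_value m g ys l (item_class g x) b))"
    using assms(3) unfolding sim_bin.simps if_not_P[OF assms(2)] .
  then show ?thesis using someI_ex[OF ex_min_reply[OF assms(1)]] by blast
qed

lemma sim_bin_less: "m \<ge> 1 \<Longrightarrow> sim_bin m g s x < m"
proof (cases s)
  case (fields ys l L)
  assume "m \<ge> 1"
  then show ?thesis
    using sim_bin_hidden[of m g l L x ys] sim_bin_visible[of m g l L x _ ys]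
    unfolding fields hidden_in_def by blast
qed

lemma sim_alg_in_algorithms: "m \<ge> 1 \<Longrightarrow> sim_alg m g \<in> algorithms m"
  by (simp add: algorithms_def sim_alg_def sim_bin_less)

text \<open>Hidden items make \<open>ys\<close> only a sub-multiset of the classes. The lower bound
  on loads is not strict because an empty bin has load and class \<open>0\<close>.\<close>

fun sim_inv :: "nat \<Rightarrow> nat \<Rightarrow> real list \<Rightarrow> nat list \<times> (nat \<Rightarrow> nat) \<times> (nat \<Rightarrow> real) \<Rightarrow> bool" where
  "sim_inv m g xs (ys, l, L) \<longleftrightarrow>
     L = alg_load (sim_alg m g) xs \<and> mset ys \<subseteq># mset (map (item_class g) xs) \<and>
     (\<forall>j. l j \<le> L j * g \<and> L j * g \<le> l j + 1) \<and> game_value m g ys l \<le> upper_bound m g"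

text \<open>A hidden item leaves the game position unchanged. A visible one is a legal round
  answered by an optimal bin, so the value does not rise.\<close>

lemma sim_inv_state:
  assumes "m \<ge> 1" "g \<ge> 1" "xs \<in> inputs m"
  shows "sim_inv m g xs (sim_state m g xs)"
  using assms(3)
proof (induction xs rule: rev_induct)
  case Nil
  show ?case by (auto simp: sim_state_def upper_bound_def)
next
  case (snoc x xs)
  have x: "0 < x" and xs: "xs \<in> inputs m" using inputs_prefix[OF snoc.prems] by auto
  obtain ys l L where s: "sim_state m g xs = (ys, l, L)" by (cases "sim_state m g xs")
  define b where "b = sim_bin m g (ys, l, L) x"
  define y where "y = item_class g x"
  define L' where "L' = L(b := L b + x)"
  have inv: "L = alg_load (sim_alg m g) xs" "mset ys \<subseteq># mset (map (item_class g) xs)"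
    "\<And>j. l j \<le> L j * g" "\<And>j. L j * g \<le> l j + 1" "game_value m g ys l \<le> upper_bound m g"
    using snoc.IH[OF xs] unfolding s by auto
  have b: "b < m" "sim_alg m g (xs @ [x]) = b"
    using assms(1) by (simp_all only: b_def sim_bin_less sim_alg_def s butlast_snoc last_snoc)
  have L': "L' = alg_load (sim_alg m g) (xs @ [x])"
    unfolding L'_def inv(1) by (rule ext) (simp add: alg_load_snoc b)
  have state: "sim_state m g (xs @ [x]) = sim_next m g (ys, l, L) x"
    unfolding sim_state_def by (simp flip: sim_state_def add: s del: sim_next.simps)
  have y: "y < x * g" "x * g \<le> y + 1"
    unfolding y_def using item_class_bounds[OF x assms(2)] by auto
  show ?case
  proof (cases "\<exists>b. hidden_in m g l L x b")
    case True
    then have "(L b + x) * g \<le> l b + 1"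
      using sim_bin_hidden[OF True, of ys] unfolding hidden_in_def b_def[symmetric] by auto
    moreover have "l b \<le> (L b + x) * g"
      using inv(3)[of b] x by (simp add: distrib_right add_increasing2)
    moreover have "mset ys \<subseteq># add_mset y (mset (map (item_class g) xs))"
      using inv(2) by (auto simp: subseteq_mset_def intro: le_SucI)
    moreover have "sim_next m g (ys, l, L) x = (ys, l, L')"
      unfolding sim_next.simps Let_def b_def[symmetric] L'_def[symmetric] if_P[OF True] ..
    ultimately show ?thesis unfolding state
      using inv(3-5) by (auto simp flip: L' simp: L'_def y_def)
  next
    case False
    define q where "q \<longleftrightarrow> l b + y + 1 < L' b * g"
    define l' where "l' = l(b := l b + (y + of_bool q))"
    have next_eq: "sim_next m g (ys, l, L) x = (ys @ [y], l', L')"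
      unfolding sim_next.simps Let_def b_def[symmetric] y_def[symmetric] L'_def[symmetric]
        q_def[symmetric] l'_def[symmetric] if_not_P[OF False] ..
    \<comment> \<open>Strict by \<open>y < x * g\<close> without overflow, and by the overflow
      condition otherwise. Strictness in this one bin brings the total class below
      \<open>m * g\<close>.\<close>
    have lower_b: "l' b < L' b * g"
      using inv(3)[of b] y by (auto simp: l'_def q_def L'_def algebra_simps)
    have lower: "l' j \<le> L' j * g" for j
      using inv(3)[of j] lower_b by (cases "j = b") (auto simp: l'_def L'_def)
    have upper: "L' j * g \<le> l' j + 1" for j
      using inv(4)[of j] y by (auto simp: l'_def q_def L'_def algebra_simps)
    have ys: "mset (ys @ [y]) \<subseteq># mset (map (item_class g) (xs @ [x]))"
      using inv(2) by (simp add: y_def)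
    have "real (\<Sum>j<m. l' j) < (\<Sum>j<m. L' j * g)"
      unfolding of_nat_sum using b(1) lower lower_b
      by (intro sum_strict_mono_ex1) auto
    also have "\<dots> = sum_list (xs @ [x]) * g"
      unfolding sum_distrib_right[symmetric] L' sum_alg_load[OF sim_alg_in_algorithms[OF assms(1)]] ..
    also have "\<dots> \<le> real m * real g"
      using sum_list_le_of_fits[of m 1 "xs @ [x]"] snoc.prems
      by (intro mult_right_mono) (auto simp: inputs_def)
    finally have "(\<Sum>j<m. l' j) < m * g" by (metis of_nat_less_iff of_nat_mult)
    moreover have "(\<Sum>j<m. l' j) = (\<Sum>j<m. l j) + (y + of_bool q)"
      unfolding l'_def using b(1) by (simp add: sum.remove[of "{..<m}" b])
    \<comment> \<open>An item of class \<open>0\<close> without overflow would have left bin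
      \<open>b\<close> within its load class, hence would have been hidden.\<close>
    moreover have "q" if "y = 0"
      using False b(1) that by (auto simp: hidden_in_def q_def L'_def y_def)
    ultimately have q: "q \<in> legal_overflows m g l y"
      by (auto simp: legal_overflows_def)
    have "fits m (g - 1) (ys @ [y])"
      using fits_subset_mset[OF fits_item_class[OF snoc.prems assms(2)] ys] .
    with q have "y \<in> legal_items m g ys l" by (auto simp: legal_items_def)
    from game_value_ge_min_reply[OF this]
    have "reply_value m g ys l y b \<le> game_value m g ys l"
      using sim_bin_visible[OF assms(1) False b_def] by (simp add: y_def)
    with reply_value_ge[OF q, of ys b] inv(5)
    have "game_value m g (ys @ [y]) l' \<le> upper_bound m g"
      by (simp add: l'_def)
    then show ?thesis unfolding state next_eq sim_inv.simps
      using L' ys lower upper by auto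
  qed
qed

lemma optimum_le_upper_bound:
  assumes "m \<ge> 1" "g \<ge> 1"
  shows "optimum_stretching_factor m \<le> upper_bound m g"
proof -
  have "stretching_factor m (sim_alg m g) \<le> upper_bound m g"
  proof (rule stretching_factor_le[OF assms(1)])
    fix xs j assume xs: "xs \<in> inputs m" and j: "j < m"
    obtain ys l L where s: "sim_state m g xs = (ys, l, L)" by (cases "sim_state m g xs")
    have inv: "L = alg_load (sim_alg m g) xs" "L j * g \<le> l j + 1"
      "game_value m g ys l \<le> upper_bound m g"
      using sim_inv_state[OF assms xs] unfolding s by auto
    have "l j \<le> (MAX j\<in>{..<m}. l j)" using j by (intro Max_ge) auto
    \<comment> \<open>The \<open>+ 1\<close> in the score absorbs the rounding of the real
      load.\<close>
    then have "L j \<le> score m g l"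
      unfolding score_def using inv(2) assms(2) by (simp add: le_divide_eq)
    with score_le_game_value[OF assms(1), of g l ys] inv(1,3)
    show "alg_load (sim_alg m g) xs j \<le> upper_bound m g" by simp
  qed
  with optimum_le_stretching_factor[OF assms(1) sim_alg_in_algorithms[OF assms(1)]]
  show ?thesis by (rule order_trans)
qed


section \<open>From online algorithms to the game\<close>

text \<open>Items of class at least \<open>K\<close> are shown to the online algorithm with the size of an
  overflow. Smaller items, whose overflow is not negligible, are poured into grains of \<open>K\<^sup>2\<close>
  units: the algorithm places the grain, and the items follow it until less than \<open>K\<close> units
  remain. One unit is worth \<open>1 / pour_scale g K\<close>, and this scale is chosen such that the resulting
  sequence fits into \<open>m\<close> unit bins by greedy packing of the grains.\<close>

definition pour_scale :: "nat \<Rightarrow> nat \<Rightarrow> real" where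
  "pour_scale g K = real K / (real K - 1) * (real g + real K ^ 2) + real K ^ 2"

text \<open>Here \<open>N\<close> counts the grains, and the last of them lies in bin \<open>b\<close> with \<open>d\<close> units left.\<close>

definition pour_inv :: "nat \<Rightarrow> nat \<Rightarrow> nat \<Rightarrow> (real list \<Rightarrow> nat) \<Rightarrow> nat list \<Rightarrow> (nat \<Rightarrow> nat) \<Rightarrow>
    real list \<Rightarrow> nat \<Rightarrow> nat \<Rightarrow> nat \<Rightarrow> bool" where
  "pour_inv m g K A ys l xs N b d \<longleftrightarrow>
     fits m (g - 1) ys \<and> (\<Sum>j<m. l j) \<le> m * g - 1 \<and> b < m \<and> d \<le> K ^ 2 \<and>
     mset xs = image_mset (\<lambda>y. (real y + 1) / pour_scale g K) (filter_mset (\<lambda>y. K \<le> y) (mset ys))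
       + replicate_mset N (real K ^ 2 / pour_scale g K) \<and>
     (\<forall>j<m. real (l j) + (if j = b then real d else 0) \<le> pour_scale g K * alg_load A xs j) \<and>
     sum_mset (filter_mset (\<lambda>y. K \<le> y) (mset ys)) + N * (K ^ 2 - K) \<le> (\<Sum>j<m. l j) + d"

section \<open>Consequences and preservation of the pouring invariant\<close>

lemma pour_inv_load:
  assumes "pour_inv m g K A ys l xs N b d" "j < m"
  shows "real (l j) + (if j = b then real d else 0) \<le> pour_scale g K * alg_load A xs j"
    and "l j \<le> pour_scale g K * alg_load A xs j"
proof -
  have "\<forall>j<m. real (l j) + (if j = b then real d else 0) \<le> pour_scale g K * alg_load A xs j"
    using assms(1) unfolding pour_inv_def by (elim conjE)
  with assms(2) show *: "real (l j) + (if j = b then real d else 0) \<le> pour_scale g K * alg_load A xs j"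
    by simp
  moreover have "0 \<le> (if j = b then real d else 0)" by simp
  ultimately show "l j \<le> pour_scale g K * alg_load A xs j" by linarith
qed

lemma pour_scale_pos: "K \<ge> 2 \<Longrightarrow> 0 < pour_scale g K"
  unfolding pour_scale_def by (intro add_nonneg_pos) auto

text \<open>For \<open>y \<ge> K\<close> the ratio \<open>(y + 1) / y\<close> is at most
  \<open>1 + 1 / K\<close>, hence at most \<open>K / (K - 1)\<close>. The latter is also the ratio
  of \<open>K ^ 2\<close> to \<open>K ^ 2 - K\<close>, so that one factor serves items and grains
  alike.\<close>

lemma sum_overflowed_le:
  fixes c :: real
  assumes "K \<ge> 2" "0 < c"
  shows "sum_mset (image_mset (\<lambda>y. (real y + 1) / c) (filter_mset (\<lambda>y. K \<le> y) M))
    \<le> real K / (real K - 1) / c * real (sum_mset (filter_mset (\<lambda>y. K \<le> y) M))"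
proof -
  define r where "r = real K / (real K - 1) / c"
  have r: "(real y + 1) / c \<le> r * y" if "K \<le> y" for y
  proof -
    have "real y + 1 \<le> real K / (real K - 1) * y"
      using that assms(1) by (simp add: field_simps)
    from divide_right_mono[OF this, of c] assms(2) show ?thesis by (simp add: r_def)
  qed
  show ?thesis
    unfolding r_def[symmetric]
  proof (induction M)
    case (add y M)
    with r[of y] show ?case by (auto simp: distrib_left intro: add_mono)
  qed simp
qed

text \<open>The big items keep the bins of the packing of \<open>ys\<close>, since \<open>c\<close>
  exceeds \<open>t * g\<close>; the grains are then added greedily, for which only the total volume
  matters.\<close>

lemma pour_inv_inputs:
  assumes "m \<ge> 1" "g \<ge> 1" "K \<ge> 2" "pour_inv m g K A ys l xs N b d"
  shows "xs \<in> inputs m"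
proof -
  define c where "c = pour_scale g K"
  define t where "t = real K / (real K - 1)"
  let ?big = "filter_mset (\<lambda>y. K \<le> y)"
  let ?size = "image_mset (\<lambda>y. (real y + 1) / c)"
  have c: "0 < c" unfolding c_def using assms(3) by (rule pour_scale_pos)
  have t: "0 \<le> t" using assms(3) by (simp add: t_def)
  have c_eq: "c = t * (real g + real K ^ 2) + real K ^ 2"
    by (simp add: c_def pour_scale_def t_def)
  have inv: "fits m (g - 1) ys" "(\<Sum>j<m. l j) \<le> m * g - 1" "d \<le> K ^ 2"
    "mset xs = ?size (?big (mset ys)) + replicate_mset N (real K ^ 2 / c)"
    "sum_mset (?big (mset ys)) + N * (K ^ 2 - K) \<le> (\<Sum>j<m. l j) + d"
    using assms(4) unfolding pour_inv_def c_def by auto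
  have "0 < x" if "x \<in> set xs" for x
  proof -
    have "x \<in># mset xs" using that by simp
    then show ?thesis unfolding inv(4) using c assms(3) by (auto split: if_splits)
  qed
  moreover have "fits m 1 xs"
  proof -
    obtain B where B: "mset ys = (\<Sum>j<m. B j)" "\<forall>j<m. sum_mset (B j) \<le> g - 1"
      using inv(1) unfolding fits_iff_mset by blast
    have "sum_mset (?size (?big (B j))) \<le> 1" if "j < m" for j
    proof -
      have "sum_mset (?big (B j)) \<le> sum_mset (B j)"
        by (metis le_add1 multiset_partition sum_mset.union)
      also have "\<dots> \<le> g" using B(2) that by force
      finally have "real (sum_mset (?big (B j))) \<le> real g"
        unfolding of_nat_le_iff .
      then have "t / c * real (sum_mset (?big (B j))) \<le> t / c * g"
        using t c by (intro mult_left_mono) auto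
      also have "\<dots> \<le> 1"
        using t c by (simp add: c_eq field_simps)
      finally show ?thesis
        using sum_overflowed_le[OF assms(3) c, of "B j"] by (simp add: t_def)
    qed
    moreover have "?size (?big (mset ys)) = (\<Sum>j<m. ?size (?big (B j)))"
      by (simp add: B(1) image_mset_sum filter_mset_sum)
    moreover have "sum_mset (?size (?big (mset ys))) + N * (real K ^ 2 / c) \<le> m * (1 - real K ^ 2 / c)"
    proof -
      \<comment> \<open>A closed grain wastes fewer than \<open>K\<close> units, so it is counted
        with \<open>K ^ 2 - K\<close> units of load; its full size is \<open>t\<close> times
        that.\<close>
      have K2: "real K ^ 2 = t * real (K ^ 2 - K)"
      proof -
        have "real (K ^ 2 - K) = real K * (real K - 1)"
          by (simp add: of_nat_diff power2_eq_square algebra_simps)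
        then show ?thesis using assms(3) by (simp add: t_def power2_eq_square)
      qed
      have "sum_mset (?big (mset ys)) + N * (K ^ 2 - K) \<le> m * g + K ^ 2"
        using inv(2,3,5) by linarith
      then have vol: "real (sum_mset (?big (mset ys))) + N * real (K ^ 2 - K) \<le> m * g + K ^ 2"
        by (metis of_nat_add of_nat_le_iff of_nat_mult)
      have "sum_mset (?size (?big (mset ys))) + N * (real K ^ 2 / c)
        \<le> t / c * real (sum_mset (?big (mset ys))) + N * (real K ^ 2 / c)"
        using sum_overflowed_le[OF assms(3) c, of "mset ys"] by (simp add: t_def)
      also have "\<dots> = t / c * (real (sum_mset (?big (mset ys))) + N * real (K ^ 2 - K))"
        by (simp add: K2 algebra_simps)
      also have "\<dots> \<le> t / c * (m * g + K ^ 2)"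
        using vol t c by (intro mult_left_mono) auto
      also have "\<dots> \<le> t / c * (m * (g + K ^ 2))"
        using t c assms(1) mult_right_mono[of 1 "real m" "real K ^ 2"]
        by (intro mult_left_mono) (auto simp: distrib_left)
      \<comment> \<open>Here the scale is determined:
        \<open>c - K ^ 2 = t * (g + K ^ 2)\<close>.\<close>
      also have "\<dots> = m * (1 - real K ^ 2 / c)"
        using c by (simp add: field_simps) (simp add: c_eq algebra_simps)
      finally show ?thesis .
    qed
    ultimately show ?thesis
      unfolding fits_iff_mset inv(4) using c assms(1)
      by (intro greedy_partition) auto
  qed
  ultimately show ?thesis by (auto simp: inputs_def)
qed

text \<open>If fewer than \<open>K\<close> units remain, they are given up and \<open>A\<close>
  receives a new grain. The loss is covered because a grain is counted with \<open>K ^ 2 - K\<close>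
  units only.\<close>

lemma pour_inv_reopen:
  assumes "A \<in> algorithms m" "K \<ge> 2" "pour_inv m g K A ys l xs N b d"
  shows "\<exists>xs N b d. pour_inv m g K A ys l xs N b d \<and> K \<le> d"
proof (cases "K \<le> d")
  case False
  let ?x = "real K ^ 2 / pour_scale g K"
  let ?b = "A (xs @ [?x])"
  have c: "0 < pour_scale g K" using assms(2) by (rule pour_scale_pos)
  have "K \<le> K ^ 2" by (simp add: power2_eq_square)
  moreover have "?b < m" using assms(1) by (simp add: algorithms_def)
  moreover have "\<forall>j<m. real (l j) + (if j = ?b then real (K ^ 2) else 0)
      \<le> pour_scale g K * alg_load A (xs @ [?x]) j"
  proof (intro allI impI)
    fix j assume "j < m"
    from pour_inv_load(2)[OF assms(3) this] show "real (l j) + (if j = ?b then real (K ^ 2) else 0) \<le> pour_scale g K * alg_load A (xs @ [?x]) j"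
      using c by (auto simp: alg_load_snoc distrib_left)
  qed
  moreover have "sum_mset (filter_mset (\<lambda>y. K \<le> y) (mset ys)) + Suc N * (K ^ 2 - K)
      \<le> (\<Sum>j<m. l j) + K ^ 2"
  proof -
    have "sum_mset (filter_mset (\<lambda>y. K \<le> y) (mset ys)) + N * (K ^ 2 - K) \<le> (\<Sum>j<m. l j) + d"
      using assms(3) unfolding pour_inv_def by (elim conjE)
    then show ?thesis using False \<open>K \<le> K ^ 2\<close> unfolding mult_Suc by linarith
  qed
  moreover have "mset (xs @ [?x]) =
      image_mset (\<lambda>y. (real y + 1) / pour_scale g K) (filter_mset (\<lambda>y. K \<le> y) (mset ys))
        + replicate_mset (Suc N) ?x"
    using assms(3) by (simp add: pour_inv_def)
  ultimately have "pour_inv m g K A ys l (xs @ [?x]) (Suc N) ?b (K ^ 2)"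
    using assms(3) unfolding pour_inv_def by (elim conjE, intro conjI) (assumption | rule order_refl)+
  then show ?thesis using \<open>K \<le> K ^ 2\<close> by blast
qed (use assms in blast)

lemma sum_load_update:
  fixes l :: "nat \<Rightarrow> nat"
  assumes "k < m"
  shows "(\<Sum>j<m. (l(k := l k + w)) j) = (\<Sum>j<m. l j) + w"
  using assms by (simp add: sum.remove[of "{..<m}" k])

text \<open>The item is shown with \<open>y + 1\<close> units, enough for either overflow decision,
  so the bin \<open>k\<close> does not depend on \<open>q\<close>.\<close>

lemma pour_inv_big:
  assumes "A \<in> algorithms m" "K \<ge> 2" "pour_inv m g K A ys l xs N b d" "K \<le> y"
    and "fits m (g - 1) (ys @ [y])" "q \<in> legal_overflows m g l y"
    and "x = (real y + 1) / pour_scale g K" "k = A (xs @ [x])"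
  shows "pour_inv m g K A (ys @ [y]) (l(k := l k + (y + of_bool q))) (xs @ [x]) N b d"
proof -
  let ?l = "l(k := l k + (y + of_bool q))"
  let ?big = "filter_mset (\<lambda>y. K \<le> y)"
  have c: "0 < pour_scale g K" using assms(2) by (rule pour_scale_pos)
  then have x: "pour_scale g K * x = real y + 1" by (simp add: assms(7))
  have "k < m" using assms(1,8) by (simp add: algorithms_def)
  note sum = sum_load_update[OF this, of l "y + of_bool q"]
  have "(\<Sum>j<m. ?l j) \<le> m * g - 1"
    using assms(6) unfolding sum by (simp add: legal_overflows_def)
  moreover have "\<forall>j<m. real (?l j) + (if j = b then real d else 0)
      \<le> pour_scale g K * alg_load A (xs @ [x]) j"
  proof (intro allI impI)
    fix j assume "j < m"
    have "real (?l j) \<le> real (l j) + (if k = j then real y + 1 else 0)" by auto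
    moreover have "pour_scale g K * alg_load A (xs @ [x]) j
      = pour_scale g K * alg_load A xs j + (if k = j then real y + 1 else 0)"
      by (auto simp: alg_load_snoc distrib_left x simp flip: assms(8))
    ultimately show "real (?l j) + (if j = b then real d else 0)
        \<le> pour_scale g K * alg_load A (xs @ [x]) j"
      using pour_inv_load(1)[OF assms(3) \<open>j < m\<close>] by linarith
  qed
  moreover have "mset (xs @ [x]) = image_mset (\<lambda>y. (real y + 1) / pour_scale g K)
      (?big (mset (ys @ [y]))) + replicate_mset N (real K ^ 2 / pour_scale g K)"
    using assms(3,4,7) by (simp add: pour_inv_def)
  moreover have "sum_mset (?big (mset (ys @ [y]))) + N * (K ^ 2 - K) \<le> (\<Sum>j<m. ?l j) + d"
  proof -
    have "sum_mset (?big (mset ys)) + N * (K ^ 2 - K) \<le> (\<Sum>j<m. l j) + d"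
      using assms(3) unfolding pour_inv_def by (elim conjE)
    then show ?thesis using assms(4) unfolding sum by simp
  qed
  ultimately show ?thesis
    using assms(3,5) unfolding pour_inv_def by (elim conjE, intro conjI) assumption+
qed

text \<open>Units move from the open grain into the load class of its bin, so \<open>A\<close> is
  not consulted. As \<open>y + 1 \<le> K \<le> d\<close>, the subtraction is exact.\<close>

lemma pour_inv_small:
  assumes "pour_inv m g K A ys l xs N b d" "y < K" "K \<le> d"
    and "fits m (g - 1) (ys @ [y])" "q \<in> legal_overflows m g l y"
  shows "pour_inv m g K A (ys @ [y]) (l(b := l b + (y + of_bool q))) xs N b (d - (y + of_bool q))"
proof -
  let ?l = "l(b := l b + (y + of_bool q))"
  let ?d = "d - (y + of_bool q)"
  let ?big = "filter_mset (\<lambda>y. K \<le> y)"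
  have b: "b < m" using assms(1) by (simp add: pour_inv_def)
  note sum = sum_load_update[OF this, of l "y + of_bool q"]
  have w: "y + of_bool q \<le> d" using assms(2,3) by auto
  have "(\<Sum>j<m. ?l j) \<le> m * g - 1"
    using assms(5) unfolding sum by (simp add: legal_overflows_def)
  moreover have "d \<le> K ^ 2"
    using assms(1) unfolding pour_inv_def by (elim conjE)
  then have "?d \<le> K ^ 2" by linarith
  moreover have "\<forall>j<m. real (?l j) + (if j = b then real ?d else 0) \<le> pour_scale g K * alg_load A xs j"
  proof (intro allI impI)
    fix j assume "j < m"
    have "real (?l j) + (if j = b then real ?d else 0) = real (l j) + (if j = b then real d else 0)"
      using w by (auto simp: of_nat_diff)
    then show "real (?l j) + (if j = b then real ?d else 0) \<le> pour_scale g K * alg_load A xs j"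
      using pour_inv_load(1)[OF assms(1) \<open>j < m\<close>] by linarith
  qed
  moreover have "mset xs = image_mset (\<lambda>y. (real y + 1) / pour_scale g K)
      (?big (mset (ys @ [y]))) + replicate_mset N (real K ^ 2 / pour_scale g K)"
    using assms(1,2) by (simp add: pour_inv_def)
  moreover have "sum_mset (?big (mset (ys @ [y]))) + N * (K ^ 2 - K) \<le> (\<Sum>j<m. ?l j) + ?d"
  proof -
    have "sum_mset (?big (mset ys)) + N * (K ^ 2 - K) \<le> (\<Sum>j<m. l j) + d"
      using assms(1) unfolding pour_inv_def by (elim conjE)
    then show ?thesis using assms(2) w unfolding sum by simp
  qed
  ultimately show ?thesis
    using assms(4) b unfolding pour_inv_def by (intro conjI) assumption+
qed

text \<open>The strategy follows \<open>A\<close> on big items and the open grain on small ones.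
  When play ends, \<open>xs\<close> is an input, so the stretching factor bounds every load.\<close>

lemma game_value_le_of_pour_inv:
  assumes "A \<in> algorithms m" "K \<ge> 2" "m \<ge> 1" "g \<ge> 1" "pour_inv m g K A ys l xs N b d"
  shows "game_value m g ys l \<le> (pour_scale g K * stretching_factor m A + 1) / g"
  using assms
proof (induction m g ys l arbitrary: xs N b d rule: game_value.induct)
  case (1 m g ys l)
  note prems = "1.prems"(1-4)
  have xs: "xs \<in> inputs m" using pour_inv_inputs[OF prems(3,4,2) "1.prems"(5)] .
  have c: "0 < pour_scale g K" using prems(2) by (rule pour_scale_pos)
  \<comment> \<open>This variant, with at least \<open>K\<close> units left in the grain, is used
    for small items; big items continue from the original \<open>xs\<close>.\<close>
  obtain xs' N' b' d' where inv: "pour_inv m g K A ys l xs' N' b' d'" and d': "K \<le> d'"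
    using pour_inv_reopen[OF prems(1,2) "1.prems"(5)] by blast
  show ?case
  proof (rule game_value_le[OF prems(3)])
    have "l j \<le> pour_scale g K * stretching_factor m A" if "j < m" for j
    proof -
      have "l j \<le> pour_scale g K * alg_load A xs j"
        using pour_inv_load(2)[OF "1.prems"(5) that] .
      moreover have "pour_scale g K * alg_load A xs j \<le> pour_scale g K * stretching_factor m A"
        using alg_load_le_stretching_factor[OF prems(1) xs that] c by simp
      ultimately show ?thesis by linarith
    qed
    moreover have "(MAX j\<in>{..<m}. l j) \<in> l ` {..<m}"
      using prems(3) by (intro Max_in) (auto simp: lessThan_empty_iff)
    ultimately have "real (MAX j\<in>{..<m}. l j) \<le> pour_scale g K * stretching_factor m A"
      by auto
    then show "score m g l \<le> (pour_scale g K * stretching_factor m A + 1) / g"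
      unfolding score_def by (intro divide_right_mono) auto
  next
    fix y assume y: "y \<in> legal_items m g ys l"
    then have fits: "fits m (g - 1) (ys @ [y])" and ne: "legal_items m g ys l \<noteq> {}"
      by (auto simp: legal_items_def)
    note IH = "1.IH"[OF ne y _ _ prems]
    show "\<exists>k<m. \<forall>q\<in>legal_overflows m g l y.
      game_value m g (ys @ [y]) (l(k := l k + (y + of_bool q)))
        \<le> (pour_scale g K * stretching_factor m A + 1) / g"
    proof (cases "K \<le> y")
      case True
      define x where "x = (real y + 1) / pour_scale g K"
      define k where "k = A (xs @ [x])"
      have "k < m" using prems(1) by (simp add: algorithms_def k_def)
      moreover have "game_value m g (ys @ [y]) (l(k := l k + (y + of_bool q)))
        \<le> (pour_scale g K * stretching_factor m A + 1) / g" if "q \<in> legal_overflows m g l y" for q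
        using IH[OF _ that pour_inv_big[OF prems(1,2) "1.prems"(5) True fits that x_def k_def]]
          \<open>k < m\<close> by (simp add: fun_upd_def)
      ultimately show ?thesis by blast
    next
      case False
      have "b' < m" using inv by (simp add: pour_inv_def)
      moreover have "game_value m g (ys @ [y]) (l(b' := l b' + (y + of_bool q)))
        \<le> (pour_scale g K * stretching_factor m A + 1) / g" if "q \<in> legal_overflows m g l y" for q
        using IH[OF _ that pour_inv_small[OF inv _ d' fits that]] False \<open>b' < m\<close> by (simp add: fun_upd_def)
      ultimately show ?thesis by blast
    qed
  qed
qed

section \<open>Comparison with the optimum and passage to the limit\<close>

lemma upper_bound_le_optimum:
  assumes "m \<ge> 1" "g \<ge> 1" "K \<ge> 2"
  shows "upper_bound m g \<le> (pour_scale g K * optimum_stretching_factor m + 1) / g"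
proof -
  have c: "0 < pour_scale g K" using assms(3) by (rule pour_scale_pos)
  \<comment> \<open>The bound is solved for the stretching factor, so that the infimum over all
    algorithms can be taken.\<close>
  have "(upper_bound m g * g - 1) / pour_scale g K \<le> stretching_factor m A"
    if "A \<in> algorithms m" for A
  proof -
    have "fits m (g - 1) []" using assms(1) by (auto simp: fits_def bin_load_def)
    \<comment> \<open>Before the first grain, bin \<open>0\<close> is a placeholder with no units
      left.\<close>
    then have "pour_inv m g K A [] (\<lambda>_. 0) [] 0 0 0"
      using assms(1) by (simp add: pour_inv_def)
    from game_value_le_of_pour_inv[OF that assms(3,1,2) this]
    show ?thesis using c assms(2) by (simp add: upper_bound_def field_simps)
  qed
  from le_optimum_stretching_factor[OF assms(1) this]
  show ?thesis using c assms(2) by (simp add: field_simps)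
qed

theorem theorem2p1:
  fixes m :: nat
  assumes "m \<ge> 1"
  shows "(\<lambda>g. upper_bound m g) \<longlonglongrightarrow> optimum_stretching_factor m"
proof (rule order_tendstoI)
  let ?v = "optimum_stretching_factor m"
  fix a assume "a < ?v"
  with optimum_le_upper_bound[OF assms] have "a < upper_bound m g" if "g \<ge> 1" for g
    using that by (meson less_le_trans)
  then show "\<forall>\<^sub>F g in sequentially. a < upper_bound m g"
    using eventually_ge_at_top[of 1] by (rule eventually_mono[rotated])
next
  let ?v = "optimum_stretching_factor m"
  fix a assume a: "?v < a"
  \<comment> \<open>\<open>K\<close> is fixed first, to make the limiting factor small enough; only
    then does \<open>g\<close> grow.\<close>
  have "(\<lambda>K. real K / (real K - 1) * ?v) \<longlonglongrightarrow> 1 * ?v"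
    by (intro tendsto_mult tendsto_const) real_asymp
  then have "\<forall>\<^sub>F K in sequentially. real K / (real K - 1) * ?v < a"
    using a by (intro order_tendstoD) auto
  with eventually_ge_at_top[of 2]
  have "\<forall>\<^sub>F K in sequentially. real K / (real K - 1) * ?v < a \<and> 2 \<le> K"
    by eventually_elim auto
  then obtain K where K: "real K / (real K - 1) * ?v < a" "K \<ge> 2"
    using eventually_happens'[of sequentially] by auto
  define t where "t = real K / (real K - 1)"
  \<comment> \<open>For fixed \<open>K\<close> the terms in \<open>K ^ 2\<close> and the rounding
    error vanish after division by \<open>g\<close>.\<close>
  have "(\<lambda>g. ((t * (real g + real K ^ 2) + real K ^ 2) * ?v + 1) / g) \<longlonglongrightarrow> t * ?v"
    by real_asymp
  then have "\<forall>\<^sub>F g in sequentially. (pour_scale g K * ?v + 1) / g < a"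
    unfolding pour_scale_def t_def[symmetric]
    using K(1) by (intro order_tendstoD) (auto simp: t_def)
  with eventually_ge_at_top[of 1] show "\<forall>\<^sub>F g in sequentially. upper_bound m g < a"
    by eventually_elim (use upper_bound_le_optimum[OF assms _ K(2)] in force)
qed

end
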